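(* Let $\Sigma$ be a finite alphabet and $\mathbb{D}$ a value domain. A property $\varPhi : \Sigma^\omega \to \mathbb{D}$ is safe and live if and only if $\varPhi(w) = \top$ for all $w \in \Sigma^\omega$.
   Context: $\Sigma^*$ and $\Sigma^\omega$ are the sets of finite and infinite words over the finite nonempty alphabet $\Sigma$; $u \prec w$ means that the finite word $u$ is a strict prefix of $w$ (the empty word is allowed). A value domain $\mathbb{D}$ is a complete lattice with $\bot \neq \top$. A property is a total function $\varPhi : \Sigma^\omega \to \mathbb{D}$. $\varPhi$ is safe when for every $w \in \Sigma^\omega$ and $v \in \mathbb{D}$ with $\varPhi(w) \not\geq v$, there is $u \prec w$ such that $\sup_{w' \in \Sigma^\omega} \varPhi(uw') \not\geq v$. $\varPhi$ is live in a domain $\mathbb{D}'$ when for all $w \in \Sigma^\omega$, if $\varPhi(w) < \sup \mathbb{D}'$, then there exists a value $v \in \mathbb{D}'$ such that $\varPhi(w) \not\geq v$ and for all prefixes $u \prec w$ we have $\sup_{w' \in \Sigma^\omega} \varPhi(uw') \geq v$. Convention: "$\varPhi$ is live" (with no domain mentioned) means that $\varPhi$ is live in $\mathbb{D}_\varPhi = \{v \in \mathbb{D} : v \leq \top_\varPhi\}$, where $\top_\varPhi = \sup_{w \in \Sigma^\omega} \varPhi(w)$, and then $\top$ denotes $\sup \mathbb{D}_\varPhi = \top_\varPhi$. *)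

theory Defs
  imports "HOL-Library.Stream"
begin

type_synonym ('a, 'd) property = "'a stream \<Rightarrow> 'd"

text \<open>A finite prefix of an infinite word is automatically strict; the empty word is allowed.\<close>

definition fin_prefix :: "'a list \<Rightarrow> 'a stream \<Rightarrow> bool"  (infix "\<prec>" 50) where
  "u \<prec> w \<longleftrightarrow> (\<exists>w'. w = u @- w')"

definition safe :: "('a, 'd::complete_lattice) property \<Rightarrow> bool" where
  "safe \<Phi> \<longleftrightarrow>
    (\<forall>w v. \<not> \<Phi> w \<ge> v \<longrightarrow> (\<exists>u. u \<prec> w \<and> \<not> (SUP w'. \<Phi> (u @- w')) \<ge> v))"

definition live_in :: "'d set \<Rightarrow> ('a, 'd::complete_lattice) property \<Rightarrow> bool" where
  "live_in D \<Phi> \<longleftrightarrow>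
    (\<forall>w. \<Phi> w < Sup D \<longrightarrow>
      (\<exists>v\<in>D. \<not> \<Phi> w \<ge> v \<and> (\<forall>u. u \<prec> w \<longrightarrow> (SUP w'. \<Phi> (u @- w')) \<ge> v)))"

definition prop_top :: "('a, 'd::complete_lattice) property \<Rightarrow> 'd" where
  "prop_top \<Phi> = (SUP w. \<Phi> w)"

definition prop_domain :: "('a, 'd::complete_lattice) property \<Rightarrow> 'd set" where
  "prop_domain \<Phi> = {v. v \<le> prop_top \<Phi>}"

lemma Sup_prop_domain: "Sup (prop_domain \<Phi>) = prop_top \<Phi>"
  unfolding prop_domain_def by (intro antisym Sup_least Sup_upper) auto

definition live :: "('a, 'd::complete_lattice) property \<Rightarrow> bool" where
  "live \<Phi> \<longleftrightarrow> live_in (prop_domain \<Phi>) \<Phi>"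

end

theory Submission
  imports Defs
begin

text \<open>Safety and liveness contradict each other at any word whose value is below the top:
  liveness yields a \<open>v\<close> not below that value which no finite prefix rules out, while
  safety demands a prefix ruling out each such \<open>v\<close>. So every word attains the
  top.\<close>

theorem proposition5p6:
  fixes \<Phi> :: "('a::finite, 'd::complete_lattice) property"
  assumes "(bot :: 'd) \<noteq> top"
  shows "safe \<Phi> \<and> live \<Phi> \<longleftrightarrow> (\<forall>w. \<Phi> w = Sup (prop_domain \<Phi>))"
proof
  assume sl: "safe \<Phi> \<and> live \<Phi>"
  show "\<forall>w. \<Phi> w = Sup (prop_domain \<Phi>)"
  proof (rule allI, rule ccontr)
    fix w
    assume "\<Phi> w \<noteq> Sup (prop_domain \<Phi>)"
    moreover have "\<Phi> w \<le> Sup (prop_domain \<Phi>)"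
      unfolding Sup_prop_domain prop_top_def by (rule SUP_upper) simp
    ultimately have "\<Phi> w < Sup (prop_domain \<Phi>)"
      by (rule le_neq_trans[rotated])
    with sl obtain v where "\<not> v \<le> \<Phi> w"
      and "\<forall>u. u \<prec> w \<longrightarrow> v \<le> (SUP w'. \<Phi> (u @- w'))"
      unfolding live_def live_in_def by blast
    with sl show False
      unfolding safe_def by blast
  qed
next
  assume const: "\<forall>w. \<Phi> w = Sup (prop_domain \<Phi>)"
  define T where "T = Sup (prop_domain \<Phi>)"
  have \<Phi>_eq: "\<Phi> = (\<lambda>_. T)"
    using const unfolding T_def by blast
  \<comment> \<open>For a constant property the supremum over continuations of any prefix is
    \<open>T\<close> itself, so the empty prefix already witnesses safety.\<close>
  have "[] \<prec> w" for w :: "'a stream"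
    by (simp add: fin_prefix_def)
  then have "safe \<Phi>"
    unfolding safe_def \<Phi>_eq by auto
  \<comment> \<open>Liveness is vacuous: no word has a value strictly below the supremum.\<close>
  moreover have "live \<Phi>"
    using const unfolding live_def live_in_def by (metis less_irrefl)
  ultimately show "safe \<Phi> \<and> live \<Phi>" ..
qed

end
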